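(* For some constant $C>0$, $C\,m(n)\le K_1(\mathrm{Tribes})\le 2m(n)$. That is: the function $k(n)=2m(n)$ belongs to $K_1(\mathrm{Tribes})$, and there is a constant $C>0$ such that no function $k(n)$ with $k(n)<C\,m(n)$ for all $n$ belongs to $K_1(\mathrm{Tribes})$.
   Context: $\mathcal{A}(n,k,p)$ is the set of all probability distributions $\mathbb{Q}$ of $n$ bits $(X_1,\ldots,X_n)\in\{0,1\}^n$ that are $k$-wise independent (every subset of at most $k$ of the bits is independent) and satisfy $\mathbb{Q}(X_i=1)=p$ for all $i$. For $f:\{0,1\}^n\to\{0,1\}$, $\varepsilon^f(k,p)=\max_{\mathbb{Q}\in\mathcal{A}(n,k,p)}\mathbb{Q}(f=1)-\min_{\mathbb{Q}\in\mathcal{A}(n,k,p)}\mathbb{Q}(f=1)$. For a sequence $f=(f_n)$ of monotone boolean functions with a sharp threshold at $p_c$ (under fully independent bits with marginal $p$, the probability of $f_n=1$ tends to $0$ for $p<p_c$ and to $1$ for $p>p_c$), $K_1(f)$ is the class of (integer-valued) functions $k(n)$ such that $\varepsilon^{f_n}(k(n),p)\to0$ as $n\to\infty$ for every $p\neq p_c$. Tribes: for an integer $m\ge1$ let $n=m2^m$, and let $m(n)$ be the inverse function. Divide the $n$ input bits into $2^m$ disjoint sets (tribes) of size $m$ each; let $y_i$ be the AND of the bits of the $i$-th tribe; $\mathrm{Tribes}_n$ is the OR of the $y_i$'s. The sequence is indexed by $n$ of the form $m2^m$ and has sharp threshold at $p_c=1/2$. *)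

theory Defs
  imports "HOL-Probability.Probability"
begin

section \<open>Distributions of n bits\<close>

text \<open>
  A vector of \<open>n\<close> bits is a function \<open>nat \<Rightarrow> bool\<close> whose coordinates outside \<open>{..<n}\<close> are pinned
  to \<open>False\<close>; this is the representation used by \<^const>\<open>Pi_pmf\<close>. The bit \<open>X\<^sub>i\<close> is the \<open>i\<close>-th
  coordinate, counted from \<open>0\<close>.
\<close>

definition bitvecs :: "nat \<Rightarrow> (nat \<Rightarrow> bool) set" where
  "bitvecs n = PiE_dflt {..<n} False (\<lambda>_. UNIV)"

definition kwise_indep :: "nat \<Rightarrow> nat \<Rightarrow> (nat \<Rightarrow> bool) pmf \<Rightarrow> bool" where
  "kwise_indep n k Q \<longleftrightarrow>
     (\<forall>J\<subseteq>{..<n}. card J \<le> k \<longrightarrow>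
        prob_space.indep_vars (measure_pmf Q) (\<lambda>_. count_space UNIV) (\<lambda>i x. x i) J)"

definition kwise_dists :: "nat \<Rightarrow> nat \<Rightarrow> real \<Rightarrow> (nat \<Rightarrow> bool) pmf set" where
  "kwise_dists n k p =
     {Q. set_pmf Q \<subseteq> bitvecs n \<and> kwise_indep n k Q \<and>
         (\<forall>i<n. measure_pmf.prob Q {x. x i} = p)}"

text \<open>
  The supremum and infimum are a maximum and a minimum for \<open>p \<in> {0..1}\<close>, see
  \<open>kwise_dists_max_attained\<close> and \<open>kwise_dists_min_attained\<close> below.
\<close>

definition eps :: "nat \<Rightarrow> ((nat \<Rightarrow> bool) \<Rightarrow> bool) \<Rightarrow> nat \<Rightarrow> real \<Rightarrow> real" where
  "eps n f k p =
     (SUP Q\<in>kwise_dists n k p. measure_pmf.prob Q {x. f x}) -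
     (INF Q\<in>kwise_dists n k p. measure_pmf.prob Q {x. f x})"


section \<open>Sequences of boolean functions\<close>

text \<open>
  A sequence of boolean functions is indexed by an infinite set \<open>N\<close> of input lengths, and
  \<open>n \<rightarrow> \<infinity>\<close> means \<open>n \<rightarrow> \<infinity>\<close> inside \<open>N\<close>.
\<close>

definition at_infinity_in :: "nat set \<Rightarrow> nat filter" where
  "at_infinity_in N = inf sequentially (principal N)"

definition monotone_bf :: "nat \<Rightarrow> ((nat \<Rightarrow> bool) \<Rightarrow> bool) \<Rightarrow> bool" where
  "monotone_bf n f \<longleftrightarrow>
     (\<forall>x\<in>bitvecs n. \<forall>y\<in>bitvecs n. (\<forall>i<n. x i \<longrightarrow> y i) \<longrightarrow> f x \<longrightarrow> f y)"

definition sharp_threshold ::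
    "nat set \<Rightarrow> (nat \<Rightarrow> (nat \<Rightarrow> bool) \<Rightarrow> bool) \<Rightarrow> real \<Rightarrow> bool" where
  "sharp_threshold N f pc \<longleftrightarrow>
     (\<forall>p\<in>{0..1}.
        let P = (\<lambda>n. measure_pmf.prob (Pi_pmf {..<n} False (\<lambda>_. bernoulli_pmf p)) {x. f n x})
        in (p < pc \<longrightarrow> (P \<longlongrightarrow> 0) (at_infinity_in N)) \<and>
           (p > pc \<longrightarrow> (P \<longlongrightarrow> 1) (at_infinity_in N)))"

text \<open>
  \<open>K1 N f pc\<close> is intended for a sequence \<open>f\<close> of monotone functions with sharp threshold at \<open>pc\<close>.
  Only the values of \<open>k\<close> on \<open>N\<close> matter.
\<close>

definition K1 ::
    "nat set \<Rightarrow> (nat \<Rightarrow> (nat \<Rightarrow> bool) \<Rightarrow> bool) \<Rightarrow> real \<Rightarrow> (nat \<Rightarrow> nat) set" where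
  "K1 N f pc =
     {k. \<forall>p\<in>{0..1}. p \<noteq> pc \<longrightarrow> ((\<lambda>n. eps n (f n) (k n) p) \<longlongrightarrow> 0) (at_infinity_in N)}"


section \<open>Tribes\<close>

definition tribes_inputs :: "nat set" where
  "tribes_inputs = (\<lambda>m. m * 2 ^ m) ` {1..}"

definition tribe_size :: "nat \<Rightarrow> nat" where
  "tribe_size = inv_into {1..} (\<lambda>m. m * 2 ^ m)"

text \<open>The \<open>i\<close>-th tribe is the block of bits \<open>i * m, \<dots>, i * m + (m - 1)\<close>.\<close>

definition tribes :: "nat \<Rightarrow> (nat \<Rightarrow> bool) \<Rightarrow> bool" where
  "tribes n x \<longleftrightarrow>
     (let m = tribe_size n in \<exists>i<2 ^ m. \<forall>j<m. x (i * m + j))"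


section \<open>Basic properties\<close>

subsection \<open>The extrema are attained\<close>

lemma finite_bitvecs: "finite (bitvecs n)"
  unfolding bitvecs_def by (rule finite_PiE_dflt) auto

lemma Pi_pmf_in_kwise_dists:
  assumes "p \<in> {0..1}"
  shows "Pi_pmf {..<n} False (\<lambda>_. bernoulli_pmf p) \<in> kwise_dists n k p"
proof -
  let ?P = "Pi_pmf {..<n} False (\<lambda>_. bernoulli_pmf p)"
  have "set_pmf ?P \<subseteq> bitvecs n"
    using set_Pi_pmf_subset'[of "{..<n}" False "\<lambda>_. bernoulli_pmf p"]
    by (auto simp: bitvecs_def PiE_dflt_def)
  moreover have "kwise_indep n k ?P"
    unfolding kwise_indep_def
    by (auto intro!: prob_space.indep_vars_subset[OF prob_space_measure_pmf indep_vars_Pi_pmf])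
  moreover have "measure_pmf.prob ?P {x. x i} = p" if "i < n" for i
  proof -
    have "measure_pmf.prob ?P {x. x i} = measure_pmf.prob (map_pmf (\<lambda>x. x i) ?P) {True}"
      by (simp add: vimage_def)
    also have "map_pmf (\<lambda>x. x i) ?P = bernoulli_pmf p"
      using that by (simp add: Pi_pmf_component)
    finally show ?thesis using assms by (simp add: measure_pmf_single)
  qed
  ultimately show ?thesis by (simp add: kwise_dists_def)
qed

lemma prob_bitvecs:
  assumes "set_pmf Q \<subseteq> bitvecs n"
  shows "measure_pmf.prob Q A = (\<Sum>x\<in>bitvecs n \<inter> A. pmf Q x)"
proof -
  have "measure_pmf.prob Q A = measure_pmf.prob Q (bitvecs n \<inter> A)"
    by (rule measure_pmf.finite_measure_eq_AE) (use assms in \<open>auto simp: AE_measure_pmf_iff\<close>)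
  thus ?thesis by (simp add: measure_measure_pmf_finite finite_bitvecs)
qed

lemma indep_vars_pmf_iff:
  "prob_space.indep_vars (measure_pmf Q) (\<lambda>_. count_space UNIV) (\<lambda>i x. x i) J \<longleftrightarrow>
     (\<forall>L. L \<subseteq> J \<longrightarrow> L \<noteq> {} \<longrightarrow> finite L \<longrightarrow>
        (\<forall>A. measure_pmf.prob Q {x. \<forall>j\<in>L. x j \<in> A j} =
              (\<Prod>j\<in>L. measure_pmf.prob Q {x. x j \<in> A j})))"
  for Q :: "(nat \<Rightarrow> bool) pmf"
proof
  assume I: "prob_space.indep_vars (measure_pmf Q) (\<lambda>_. count_space UNIV) (\<lambda>i x. x i) J"
  show "\<forall>L. L \<subseteq> J \<longrightarrow> L \<noteq> {} \<longrightarrow> finite L \<longrightarrow>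
        (\<forall>A. measure_pmf.prob Q {x. \<forall>j\<in>L. x j \<in> A j} =
              (\<Prod>j\<in>L. measure_pmf.prob Q {x. x j \<in> A j}))"
  proof (intro allI impI)
    fix L A assume L: "L \<subseteq> J" "L \<noteq> {}" "finite (L :: nat set)"
    have "measure_pmf.prob Q (\<Inter>j\<in>L. (\<lambda>x. x j) -` A j \<inter> space (measure_pmf Q)) =
        (\<Prod>j\<in>L. measure_pmf.prob Q ((\<lambda>x. x j) -` A j \<inter> space (measure_pmf Q)))"
      by (rule prob_space.indep_varsD[OF prob_space_measure_pmf I]) (use L in auto)
    moreover have "(\<Inter>j\<in>L. (\<lambda>x. x j) -` A j) = {x. \<forall>j\<in>L. x j \<in> A j}" by auto
    ultimately show "measure_pmf.prob Q {x. \<forall>j\<in>L. x j \<in> A j} =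
              (\<Prod>j\<in>L. measure_pmf.prob Q {x. x j \<in> A j})"
      by (simp add: vimage_def)
  qed
next
  assume R: "\<forall>L. L \<subseteq> J \<longrightarrow> L \<noteq> {} \<longrightarrow> finite L \<longrightarrow>
        (\<forall>A. measure_pmf.prob Q {x. \<forall>j\<in>L. x j \<in> A j} =
              (\<Prod>j\<in>L. measure_pmf.prob Q {x. x j \<in> A j}))"
  show "prob_space.indep_vars (measure_pmf Q) (\<lambda>_. count_space UNIV) (\<lambda>i x. x i) J"
    unfolding prob_space.indep_vars_def2[OF prob_space_measure_pmf]
  proof (intro conjI ballI prob_space.indep_setsI[OF prob_space_measure_pmf])
    fix A L assume L: "L \<noteq> {}" "L \<subseteq> J" "finite L"
      and A: "\<forall>j\<in>L. A j \<in> {(\<lambda>x. x j) -` B \<inter> space (measure_pmf Q) |B. B \<in> sets (count_space UNIV)}"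
    from A obtain B where B: "\<And>j. j \<in> L \<Longrightarrow> A j = {x. x j \<in> B j}"
      by (simp add: vimage_def) metis
    have "(\<Inter>j\<in>L. A j) = {x. \<forall>j\<in>L. x j \<in> B j}" using B by auto
    moreover have "(\<Prod>j\<in>L. measure_pmf.prob Q (A j)) = (\<Prod>j\<in>L. measure_pmf.prob Q {x. x j \<in> B j})"
      using B by (intro prod.cong) auto
    ultimately show "measure_pmf.prob Q (\<Inter>j\<in>L. A j) = (\<Prod>j\<in>L. measure_pmf.prob Q (A j))"
      using R L by simp
  qed auto
qed

lemma compact_kwise_dists: "compact (pmf ` kwise_dists n k p)"
proof -
  define S where "S = bitvecs n"
  define M where "M A g = (\<Sum>x\<in>S \<inter> A. g x)" for A and g :: "(nat \<Rightarrow> bool) \<Rightarrow> real"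
  have [simp]: "finite S" by (simp add: S_def finite_bitvecs)
  have cont: "continuous_on UNIV (M A)" for A
    unfolding M_def by (intro continuous_on_sum continuous_on_product_coordinates)
  have prob: "measure_pmf.prob Q A = M A (pmf Q)" if "set_pmf Q \<subseteq> S" for Q A
    using prob_bitvecs[of Q n A] that by (simp add: M_def S_def)
  define Bx where "Bx = (PiE UNIV (\<lambda>_. {0..1}) :: ((nat \<Rightarrow> bool) \<Rightarrow> real) set)"
  define F0 where "F0 = (\<Inter>x\<in>-S. {g. g x = (0::real)}) \<inter> {g. M UNIV g = 1}"
  define F1 where "F1 = (\<Inter>i\<in>{..<n}. {g. M {x. x i} g = p})"
  define F2 where "F2 = (\<Inter>J\<in>{J. J \<subseteq> {..<n} \<and> card J \<le> k}. \<Inter>L\<in>{L. L \<subseteq> J \<and> L \<noteq> {} \<and> finite L}. \<Inter>A.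
      {g. M {x. \<forall>j\<in>L. x j \<in> A j} g = (\<Prod>j\<in>L. M {x. x j \<in> A j} g)})"
  have "compactin (product_topology (\<lambda>_. euclidean) UNIV) Bx"
    unfolding Bx_def by (subst compactin_PiE) auto
  hence "compact Bx" by (simp add: euclidean_product_topology)
  moreover have "closed F0"
    unfolding F0_def
    by (intro closed_Int closed_INT ballI closed_Collect_eq cont continuous_on_product_coordinates)
       auto
  moreover have "closed F1"
    unfolding F1_def by (intro closed_INT ballI closed_Collect_eq cont) auto
  moreover have "closed F2"
    unfolding F2_def by (intro closed_INT ballI closed_Collect_eq cont continuous_on_prod)
  ultimately have "compact (Bx \<inter> F0 \<inter> F1 \<inter> F2)"
    by (intro compact_Int_closed)
  moreover have "Bx \<inter> F0 \<inter> F1 \<inter> F2 = pmf ` kwise_dists n k p"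
  proof (intro equalityI subsetI)
    fix g assume g: "g \<in> Bx \<inter> F0 \<inter> F1 \<inter> F2"
    have nn: "g x \<ge> 0" for x using g by (auto simp: Bx_def PiE_def Pi_def)
    have z: "g x = 0" if "x \<notin> S" for x using g that by (auto simp: F0_def)
    have "(\<integral>\<^sup>+ x. ennreal (g x) \<partial>count_space UNIV) = (\<integral>\<^sup>+ x. ennreal (g x) \<partial>count_space S)"
      by (rule nn_integral_count_space_eq) (use z in auto)
    also have "\<dots> = (\<Sum>x\<in>S. ennreal (g x))" by (simp add: nn_integral_count_space_finite)
    also have "\<dots> = 1" using g nn by (simp add: F0_def M_def)
    finally have one: "(\<integral>\<^sup>+ x. ennreal (g x) \<partial>count_space UNIV) = 1" .
    define Q where "Q = embed_pmf g"
    have Q: "pmf Q = g" unfolding Q_def using nn one by (auto simp: pmf_embed_pmf)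
    have sub: "set_pmf Q \<subseteq> S" using z by (auto simp: set_pmf_eq Q)
    have "Q \<in> kwise_dists n k p"
      unfolding kwise_dists_def kwise_indep_def indep_vars_pmf_iff
      using sub g by (auto simp: prob[OF sub] Q F1_def F2_def S_def)
    thus "g \<in> pmf ` kwise_dists n k p" using Q by blast
  next
    fix g assume "g \<in> pmf ` kwise_dists n k p"
    then obtain Q where Q: "g = pmf Q" "Q \<in> kwise_dists n k p" by blast
    have sub: "set_pmf Q \<subseteq> S" using Q by (simp add: kwise_dists_def S_def)
    have "g \<in> Bx" by (auto simp: Bx_def Q pmf_le_1)
    moreover have "g \<in> F0"
      using sub prob[OF sub, of UNIV] by (auto simp: F0_def Q set_pmf_eq)
    moreover have "g \<in> F1 \<inter> F2"
      using Q(2) unfolding kwise_dists_def kwise_indep_def indep_vars_pmf_iff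
      by (auto simp: prob[OF sub] F1_def F2_def Q(1))
    ultimately show "g \<in> Bx \<inter> F0 \<inter> F1 \<inter> F2" by blast
  qed
  ultimately show ?thesis by simp
qed

lemma kwise_dists_max_attained:
  assumes "p \<in> {0..1}"
  obtains Q where "Q \<in> kwise_dists n k p"
    and "measure_pmf.prob Q {x. f x} = (SUP Q\<in>kwise_dists n k p. measure_pmf.prob Q {x. f x})"
proof -
  define h where "h g = (\<Sum>x\<in>bitvecs n \<inter> {x. f x}. g x)" for g :: "(nat \<Rightarrow> bool) \<Rightarrow> real"
  have h: "measure_pmf.prob Q {x. f x} = h (pmf Q)" if "Q \<in> kwise_dists n k p" for Q
    unfolding h_def using that by (intro prob_bitvecs) (simp add: kwise_dists_def)
  have "continuous_on (pmf ` kwise_dists n k p) h"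
    unfolding h_def
    by (intro continuous_on_sum continuous_on_subset[OF continuous_on_product_coordinates]) auto
  then obtain Q where Q: "Q \<in> kwise_dists n k p"
      "\<And>R. R \<in> kwise_dists n k p \<Longrightarrow> h (pmf R) \<le> h (pmf Q)"
    using continuous_attains_sup[OF compact_kwise_dists, of n k p h]
      Pi_pmf_in_kwise_dists[OF assms] by blast
  have "(SUP Q\<in>kwise_dists n k p. measure_pmf.prob Q {x. f x}) = measure_pmf.prob Q {x. f x}"
    using Q by (intro cSup_eq_maximum) (auto simp: h)
  with Q(1) that show ?thesis by metis
qed

lemma kwise_dists_min_attained:
  assumes "p \<in> {0..1}"
  obtains Q where "Q \<in> kwise_dists n k p"
    and "measure_pmf.prob Q {x. f x} = (INF Q\<in>kwise_dists n k p. measure_pmf.prob Q {x. f x})"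
proof -
  define h where "h g = (\<Sum>x\<in>bitvecs n \<inter> {x. f x}. g x)" for g :: "(nat \<Rightarrow> bool) \<Rightarrow> real"
  have h: "measure_pmf.prob Q {x. f x} = h (pmf Q)" if "Q \<in> kwise_dists n k p" for Q
    unfolding h_def using that by (intro prob_bitvecs) (simp add: kwise_dists_def)
  have "continuous_on (pmf ` kwise_dists n k p) h"
    unfolding h_def
    by (intro continuous_on_sum continuous_on_subset[OF continuous_on_product_coordinates]) auto
  then obtain Q where Q: "Q \<in> kwise_dists n k p"
      "\<And>R. R \<in> kwise_dists n k p \<Longrightarrow> h (pmf R) \<ge> h (pmf Q)"
    using continuous_attains_inf[OF compact_kwise_dists, of n k p h]
      Pi_pmf_in_kwise_dists[OF assms] by blast
  have "(INF Q\<in>kwise_dists n k p. measure_pmf.prob Q {x. f x}) = measure_pmf.prob Q {x. f x}"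
    using Q by (intro cInf_eq_minimum) (auto simp: h)
  with Q(1) that show ?thesis by metis
qed

subsection \<open>Tribes is monotone with sharp threshold at 1/2\<close>

lemma strict_mono_tribes_input: "strict_mono (\<lambda>m::nat. m * 2 ^ m :: nat)"
  by (rule strict_mono_Suc_iff[THEN iffD2]) auto

lemma tribe_size_input: "m \<ge> 1 \<Longrightarrow> tribe_size (m * 2 ^ m) = m"
  unfolding tribe_size_def
  using inv_into_f_f[of "\<lambda>m::nat. m * 2 ^ m :: nat" "{1..}" m] strict_mono_tribes_input
  by (simp add: strict_mono_imp_inj_on)

lemma tribe_size_props:
  assumes "n \<in> tribes_inputs"
  shows "tribe_size n \<ge> 1" "tribe_size n * 2 ^ tribe_size n = n"
  using assms tribe_size_input by (auto simp: tribes_inputs_def)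

lemma tribe_bit_less:
  fixes i j m :: nat
  assumes "i < 2 ^ m" "j < m"
  shows "i * m + j < m * 2 ^ m"
proof -
  have "i * m + j < Suc i * m" using assms by simp
  also have "\<dots> \<le> 2 ^ m * m" using assms by (intro mult_right_mono) auto
  finally show ?thesis by (simp add: mult.commute)
qed

lemma monotone_tribes:
  assumes "n \<in> tribes_inputs"
  shows "monotone_bf n (tribes n)"
proof -
  have "i * tribe_size n + j < n" if "i < 2 ^ tribe_size n" "j < tribe_size n" for i j
    using tribe_bit_less[OF that] tribe_size_props[OF assms] by simp
  thus ?thesis unfolding monotone_bf_def tribes_def Let_def by meson
qed

lemma tendsto_tribes_inputs:
  assumes "(\<lambda>m. F (m * 2 ^ m)) \<longlonglongrightarrow> (c :: real)"
  shows "(F \<longlongrightarrow> c) (at_infinity_in tribes_inputs)"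
proof (rule topological_tendstoI)
  fix S assume "open S" "c \<in> S"
  then obtain m0 where m0: "\<And>m. m \<ge> m0 \<Longrightarrow> F (m * 2 ^ m) \<in> S"
    using topological_tendstoD[OF assms] by (auto simp: eventually_sequentially)
  have "F n \<in> S" if "n \<ge> m0 * 2 ^ m0" "n \<in> tribes_inputs" for n
    using that m0 strict_mono_less_eq[OF strict_mono_tribes_input]
    by (auto simp: tribes_inputs_def)
  thus "eventually (\<lambda>n. F n \<in> S) (at_infinity_in tribes_inputs)"
    by (auto simp: at_infinity_in_def eventually_inf_principal eventually_sequentially)
qed

lemma prob_Pi_pmf_all_ones:
  fixes n :: nat
  assumes "p \<in> {0..1}" "L \<subseteq> {..<n}"
  shows "measure_pmf.prob (Pi_pmf {..<n} False (\<lambda>_. bernoulli_pmf p)) {x. \<forall>i\<in>L. x i} = p ^ card L"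
proof -
  let ?B = "\<lambda>i. if i \<in> L then {True} else UNIV"
  have "{x. \<forall>i\<in>L. x i} = Pi {..<n} ?B" using assms(2) by (auto simp: Pi_def)
  also have "measure_pmf.prob (Pi_pmf {..<n} False (\<lambda>_. bernoulli_pmf p)) (Pi {..<n} ?B) =
      (\<Prod>i<n. measure_pmf.prob (bernoulli_pmf p) (?B i))"
    by (rule measure_Pi_pmf_Pi) simp
  also have "\<dots> = (\<Prod>i<n. if i \<in> L then p else 1)"
    using assms(1) by (intro prod.cong) (auto simp: measure_pmf_single)
  also have "\<dots> = (\<Prod>i\<in>L. p)"
    using assms(2) by (simp add: prod.If_cases Int_absorb1)
  finally show ?thesis by simp
qed

lemma prob_tribes:
  assumes p: "p \<in> {0..1}" and m: "m \<ge> 1"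
  defines "n \<equiv> m * 2 ^ m"
  shows "measure_pmf.prob (Pi_pmf {..<n} False (\<lambda>_. bernoulli_pmf p)) {x. tribes n x} =
           1 - (1 - p ^ m) ^ (2 ^ m)"
proof -
  let ?P = "Pi_pmf {..<n} False (\<lambda>_. bernoulli_pmf p)"
  define T where "T i = {i * m..<i * m + m}" for i
  have sub: "T i \<subseteq> {..<n}" if "i < 2 ^ m" for i
  proof
    fix x assume "x \<in> T i"
    then obtain j where "x = i * m + j" "j < m"
      using that[of "x - i * m"] by (auto simp: T_def)
    thus "x \<in> {..<n}" using tribe_bit_less[of i m j] that by (simp add: n_def)
  qed
  have div: "x div m = i" if "x \<in> T i" for x i
    using that m by (auto simp: T_def algebra_simps intro!: div_nat_eqI)
  have disj: "disjoint_family_on T {..<2 ^ m}"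
    unfolding disjoint_family_on_def using div by blast
  have tr: "tribes n x \<longleftrightarrow> (\<exists>i<2 ^ m. \<forall>l\<in>T i. x l)" for x
  proof -
    have "(\<forall>j<m. x (i * m + j)) \<longleftrightarrow> (\<forall>l\<in>T i. x l)" for i
    proof
      assume a: "\<forall>j<m. x (i * m + j)"
      show "\<forall>l\<in>T i. x l"
      proof
        fix l assume "l \<in> T i"
        thus "x l" using a[rule_format, of "l - i * m"] by (auto simp: T_def)
      qed
    qed (auto simp: T_def)
    thus ?thesis using m by (simp add: tribes_def n_def tribe_size_input)
  qed
  have "prob_space.indep_vars (measure_pmf ?P) (\<lambda>i. PiM (T i) (\<lambda>_. count_space UNIV))
          (\<lambda>i x. restrict (\<lambda>l. x l) (T i)) {..<2 ^ m}"
    by (rule prob_space.indep_vars_restrict[OF prob_space_measure_pmf indep_vars_Pi_pmf]) (use sub disj in auto)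
  hence "prob_space.indep_vars (measure_pmf ?P) (\<lambda>_. count_space UNIV)
          (\<lambda>i x. \<forall>l\<in>T i. restrict (\<lambda>l. x l) (T i) l) {..<2 ^ m}"
    by (rule prob_space.indep_vars_compose2[OF prob_space_measure_pmf]) (simp add: T_def)
  hence I: "prob_space.indep_vars (measure_pmf ?P) (\<lambda>_. count_space UNIV) (\<lambda>i x. \<forall>l\<in>T i. x l) {..<2 ^ m}"
    by simp
  have "measure_pmf.prob ?P (\<Inter>i\<in>{..<2 ^ m}. (\<lambda>x. \<forall>l\<in>T i. x l) -` {False} \<inter> space ?P) =
      (\<Prod>i\<in>{..<2 ^ m}. measure_pmf.prob ?P ((\<lambda>x. \<forall>l\<in>T i. x l) -` {False} \<inter> space ?P))"
    by (rule prob_space.indep_varsD[OF prob_space_measure_pmf I]) (auto simp: lessThan_empty_iff)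
  also have "\<dots> = (\<Prod>i\<in>{..<2 ^ m :: nat}. 1 - p ^ m)"
  proof (intro prod.cong refl)
    fix i :: nat assume i: "i \<in> {..<2 ^ m}"
    have "(\<lambda>x. \<forall>l\<in>T i. x l) -` {False} = space ?P - {x. \<forall>l\<in>T i. x l}" by auto
    thus "measure_pmf.prob ?P ((\<lambda>x. \<forall>l\<in>T i. x l) -` {False} \<inter> space ?P) = 1 - p ^ m"
      using prob_Pi_pmf_all_ones[OF p sub, of i] i
      by (simp add: measure_pmf.prob_compl T_def Int_absorb2 del: space_measure_pmf)
  qed
  also have "(\<Inter>i\<in>{..<2 ^ m}. (\<lambda>x. \<forall>l\<in>T i. x l) -` {False} \<inter> space ?P) = space ?P - {x. tribes n x}"
    by (auto simp: tr)
  also have "measure_pmf.prob ?P \<dots> = 1 - measure_pmf.prob ?P {x. tribes n x}"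
    by (rule measure_pmf.prob_compl) simp
  finally show ?thesis by simp
qed

lemma sharp_threshold_tribes: "sharp_threshold tribes_inputs tribes (1/2)"
proof -
  have "((\<lambda>n. measure_pmf.prob (Pi_pmf {..<n} False (\<lambda>_. bernoulli_pmf p)) {x. tribes n x}) \<longlongrightarrow>
           (if p < 1/2 then 0 else 1)) (at_infinity_in tribes_inputs)"
    if p: "p \<in> {0..1}" "p \<noteq> 1/2" for p :: real
  proof (rule tendsto_tribes_inputs)
    have pm: "0 \<le> p ^ m" "p ^ m \<le> 1" for m using p by (auto intro: power_le_one)
    have "(\<lambda>m. 1 - (1 - p ^ m) ^ (2 ^ m)) \<longlonglongrightarrow> (if p < 1/2 then 0 else 1)"
    proof (cases "p < 1/2")
      case True
      have "(\<lambda>m. (2 * p) ^ m) \<longlonglongrightarrow> 0" using True p by (intro LIMSEQ_power_zero) auto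
      moreover have "1 - (1 - p ^ m) ^ (2 ^ m) \<le> (2 * p) ^ m" for m
        using Bernoulli_inequality[of "- (p ^ m)" "2 ^ m"] pm[of m]
        by (simp add: power_mult_distrib)
      moreover have "0 \<le> 1 - (1 - p ^ m) ^ (2 ^ m)" for m
        using pm[of m] by (simp add: power_le_one)
      ultimately have "(\<lambda>m. 1 - (1 - p ^ m) ^ (2 ^ m)) \<longlonglongrightarrow> 0"
        by - (rule tendsto_sandwich[where f = "\<lambda>_. 0" and h = "\<lambda>m. (2 * p) ^ m"], auto)
      thus ?thesis using True by simp
    next
      case False
      hence "filterlim (\<lambda>m. (2 * p) ^ m) at_top sequentially"
        using p
        by - (rule filterlim_at_infinity_imp_filterlim_at_top[OF filterlim_realpow_sequentially_gt1], auto)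
      hence "((\<lambda>m. exp (- ((2 * p) ^ m))) \<longlonglongrightarrow> 0)"
        by (intro filterlim_compose[OF exp_at_bot]) (simp add: filterlim_uminus_at_top)
      moreover have "(1 - p ^ m) ^ (2 ^ m) \<le> exp (- ((2 * p) ^ m))" for m
      proof -
        have "(1 - p ^ m) ^ (2 ^ m) \<le> exp (- (p ^ m)) ^ (2 ^ m)"
          using pm[of m] exp_ge_add_one_self[of "- (p ^ m)"] by (intro power_mono) auto
        also have "\<dots> = exp (- ((2 * p) ^ m))"
          by (simp add: exp_of_nat_mult[symmetric] power_mult_distrib)
        finally show ?thesis .
      qed
      moreover have "0 \<le> (1 - p ^ m) ^ (2 ^ m)" for m using pm[of m] by simp
      ultimately have "(\<lambda>m. (1 - p ^ m) ^ (2 ^ m)) \<longlonglongrightarrow> 0"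
        by - (rule tendsto_sandwich[where f = "\<lambda>_. 0" and h = "\<lambda>m. exp (- ((2 * p) ^ m))"], auto)
      from tendsto_diff[OF tendsto_const[of 1] this] show ?thesis using False by simp
    qed
    moreover have "eventually (\<lambda>m. measure_pmf.prob (Pi_pmf {..<m * 2 ^ m} False (\<lambda>_. bernoulli_pmf p))
        {x. tribes (m * 2 ^ m) x} = 1 - (1 - p ^ m) ^ (2 ^ m)) sequentially"
      using eventually_ge_at_top[of 1] by eventually_elim (use prob_tribes p in blast)
    ultimately show "(\<lambda>m. measure_pmf.prob (Pi_pmf {..<m * 2 ^ m} False (\<lambda>_. bernoulli_pmf p))
        {x. tribes (m * 2 ^ m) x}) \<longlonglongrightarrow> (if p < 1/2 then 0 else 1)"
      by (simp add: tendsto_cong)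
  qed
  note lim = this
  show ?thesis
    unfolding sharp_threshold_def Let_def
  proof (intro ballI conjI impI, goal_cases)
    case (1 p)
    thus ?case using lim[of p] by simp
  next
    case (2 p)
    thus ?case using lim[of p] by simp
  qed
qed

end

theory Submission
  imports Defs
begin

text \<open>
  If \<open>k \<ge> 2 * m\<close>, the events that a given tribe is all ones have probability \<open>p ^ m\<close> and are
  pairwise independent. The probability of Tribes is then at most \<open>(2 * p) ^ m\<close> by the union bound
  and at least \<open>1 - 1 / (2 * p) ^ m\<close> by Chebyshev, which settles \<open>p < 1/2\<close> and \<open>p > 1/2\<close>.

  Conversely, take \<open>p = 2/5\<close> and a code \<open>D\<close> of length \<open>m\<close> with minimum distance above
  \<open>k \<le> m / 8\<close>. The square of the sum of the Walsh characters indexed by \<open>D\<close>, thinned to bias \<open>p\<close>,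
  is a \<open>k\<close>-wise independent distribution of one tribe that is all ones with probability
  \<open>card D * p ^ m\<close>, and by the Gilbert--Varshamov bound this can be made at least \<open>1 / 2 ^ m\<close>. With
  independent tribes of this kind, Tribes holds with probability at least \<open>1 - exp (- 1)\<close>, although
  under independent bits this probability tends to \<open>0\<close>.
\<close>

section \<open>Codes\<close>

text \<open>Expanding the product of sums gives one term per subset of \<open>{..<n}\<close>, that
  is, per bit vector. All sums over the cube below factor over the coordinates in this way.\<close>

lemma sum_prod_bitvecs:
  fixes h :: "nat \<Rightarrow> bool \<Rightarrow> real"
  shows "(\<Sum>x\<in>bitvecs n. \<Prod>i<n. h i (x i)) = (\<Prod>i<n. h i True + h i False)"
proof -
  have "(\<Prod>i<n. h i True + h i False) =
      (\<Sum>X\<in>Pow {..<n}. (\<Prod>i\<in>X. h i True) * (\<Prod>i\<in>{..<n} - X. h i False))"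
    by (rule prod_add) simp
  also have "\<dots> = (\<Sum>X\<in>Pow {..<n}. \<Prod>i<n. h i (i \<in> X))"
  proof (rule sum.cong[OF refl])
    fix X assume X: "X \<in> Pow {..<n}"
    have "(\<Prod>i<n. h i (i \<in> X)) = (\<Prod>i\<in>{..<n} - X. h i (i \<in> X)) * (\<Prod>i\<in>X. h i (i \<in> X))"
      using X by (intro prod.subset_diff) auto
    also have "\<dots> = (\<Prod>i\<in>X. h i True) * (\<Prod>i\<in>{..<n} - X. h i False)"
      by (subst mult.commute) (auto intro!: arg_cong2[where f = "(*)"] prod.cong)
    finally show "(\<Prod>i\<in>X. h i True) * (\<Prod>i\<in>{..<n} - X. h i False) = (\<Prod>i<n. h i (i \<in> X))" ..
  qed
  also have "\<dots> = (\<Sum>x\<in>bitvecs n. \<Prod>i<n. h i (x i))"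
    by (rule sum.reindex_bij_witness[where i = "\<lambda>x. {i. x i}" and j = "\<lambda>X i. i \<in> X"])
       (auto simp: bitvecs_def PiE_dflt_def)
  finally show ?thesis ..
qed

lemma card_bitvecs: "real (card (bitvecs n)) = 2 ^ n"
  using sum_prod_bitvecs[of "\<lambda>_ _. 1" n] by simp

definition hamming :: "nat \<Rightarrow> (nat \<Rightarrow> bool) \<Rightarrow> (nat \<Rightarrow> bool) \<Rightarrow> nat" where
  "hamming n x y = card {i. i < n \<and> x i \<noteq> y i}"

text \<open>The distance is strictly above \<open>k\<close>, so no set of at most \<open>k\<close>
  coordinates contains all positions where two codewords differ. Nonemptiness makes division by
  \<open>card D\<close> meaningful.\<close>

definition code :: "nat \<Rightarrow> nat \<Rightarrow> (nat \<Rightarrow> bool) set \<Rightarrow> bool" where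
  "code n k D \<longleftrightarrow> D \<noteq> {} \<and> D \<subseteq> bitvecs n \<and> (\<forall>c\<in>D. \<forall>c'\<in>D. c \<noteq> c' \<longrightarrow> k < hamming n c c')"

lemma hamming_commute: "hamming n x y = hamming n y x"
  unfolding hamming_def by (simp add: eq_commute)

lemma power_hamming:
  fixes t :: real
  shows "t ^ hamming n x c = (\<Prod>i<n. if x i \<noteq> c i then t else 1)"
proof -
  have "(\<Prod>i<n. if x i \<noteq> c i then t else 1) = (\<Prod>i\<in>{i. i < n \<and> x i \<noteq> c i}. t)"
    by (rule prod.mono_neutral_cong_right) auto
  thus ?thesis by (simp add: hamming_def)
qed

text \<open>In a code maximal under inclusion, a vector farther than \<open>k\<close> from every
  codeword could still be added.\<close>

lemma maximal_code_covers:
  obtains D where "code n k D" and "\<And>x. x \<in> bitvecs n \<Longrightarrow> \<exists>c\<in>D. hamming n x c \<le> k"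
proof -
  have fin: "finite {D. code n k D}"
    by (rule finite_subset[of _ "Pow (bitvecs n)"]) (auto simp: code_def finite_bitvecs)
  have "code n k {\<lambda>_. False}" by (simp add: code_def bitvecs_def PiE_dflt_def)
  hence ne: "{D. code n k D} \<noteq> {}" by blast
  obtain D where D: "code n k D" "\<And>D'. code n k D' \<Longrightarrow> D \<subseteq> D' \<Longrightarrow> D = D'"
    using finite_has_maximal[OF fin ne] by auto
  have "\<exists>c\<in>D. hamming n x c \<le> k" if x: "x \<in> bitvecs n" for x
  proof (rule ccontr)
    assume far: "\<not> (\<exists>c\<in>D. hamming n x c \<le> k)"
    hence "k < hamming n x c \<and> k < hamming n c x" if "c \<in> D" for c
      using that hamming_commute[of n x c] by (metis not_le)
    hence "code n k (insert x D)"
      using D(1) x by (auto simp: code_def)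
    with D(2) have "x \<in> D" by blast
    with far show False by (auto simp: hamming_def)
  qed
  with D(1) that show ?thesis by blast
qed

text \<open>
  The Gilbert--Varshamov bound. The weight \<open>t\<close> replaces the volume of the Hamming ball by its
  Chernoff estimate.
\<close>
lemma large_code_exists:
  fixes t :: real
  assumes t: "0 < t" "t \<le> 1"
  obtains D where "code n k D" and "2 ^ n * t ^ k \<le> card D * (1 + t) ^ n"
proof -
  obtain D where D: "code n k D" and cov: "\<And>x. x \<in> bitvecs n \<Longrightarrow> \<exists>c\<in>D. hamming n x c \<le> k"
    using maximal_code_covers by blast
  have fin: "finite D" using D finite_subset finite_bitvecs by (auto simp: code_def)
  have "2 ^ n * t ^ k = (\<Sum>x\<in>bitvecs n. t ^ k)"
    by (simp add: card_bitvecs)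
  \<comment> \<open>The codeword covering \<open>x\<close> alone contributes at least
    \<open>t ^ k\<close>, because \<open>t \<le> 1\<close>.\<close>
  also have "\<dots> \<le> (\<Sum>x\<in>bitvecs n. \<Sum>c\<in>D. t ^ hamming n x c)"
  proof (rule sum_mono)
    fix x assume "x \<in> bitvecs n"
    then obtain c where c: "c \<in> D" "hamming n x c \<le> k" using cov by blast
    have "t ^ k \<le> t ^ hamming n x c" using c t by (intro power_decreasing) auto
    also have "\<dots> \<le> (\<Sum>c\<in>D. t ^ hamming n x c)"
      using c fin t by (intro member_le_sum) auto
    finally show "t ^ k \<le> (\<Sum>c\<in>D. t ^ hamming n x c)" .
  qed
  also have "\<dots> = (\<Sum>c\<in>D. \<Sum>x\<in>bitvecs n. t ^ hamming n x c)"
    by (rule sum.swap)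
  also have "\<dots> = (\<Sum>c\<in>D. (1 + t) ^ n)"
  proof (rule sum.cong[OF refl])
    fix c
    have "(\<Sum>x\<in>bitvecs n. t ^ hamming n x c) =
        (\<Prod>i<n. (if True \<noteq> c i then t else 1) + (if False \<noteq> c i then t else 1))"
      unfolding power_hamming using sum_prod_bitvecs[of "\<lambda>i b. if b \<noteq> c i then t else 1"] .
    \<comment> \<open>Exactly one bit value differs from \<open>c i\<close>, so the sum is the same
      for every centre \<open>c\<close>.\<close>
    also have "\<dots> = (\<Prod>i<n. 1 + t)" by (intro prod.cong) auto
    finally show "(\<Sum>x\<in>bitvecs n. t ^ hamming n x c) = (1 + t) ^ n" by simp
  qed
  finally show ?thesis using D that by simp
qed


section \<open>Biased distributions from codes\<close>

text \<open>
  The Walsh characters are normalised to be \<open>1\<close> at the all-ones vector. The square of their sum over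
  a code \<open>D\<close>, divided by \<open>card D\<close>, is a density for uniform bits whose Fourier coefficients live on
  differences of codewords. Replacing each one by a zero with probability \<open>1 - 2 * p\<close>,
  independently, yields the following weights.
\<close>
definition code_weight :: "nat \<Rightarrow> real \<Rightarrow> (nat \<Rightarrow> bool) set \<Rightarrow> (nat \<Rightarrow> bool) \<Rightarrow> real" where
  "code_weight n p D y =
     (\<Sum>c\<in>D. \<Sum>c'\<in>D. \<Prod>i<n. if y i then p else if c i = c' i then 1 - p else - p) / card D"

text \<open>Summing over the vector \<open>x\<close> before thinning turns the double sum over
  codewords into a nonnegative combination of squares of character sums.\<close>

lemma code_weight_nonneg:
  assumes p: "0 \<le> p" "p \<le> 1/2"
  shows "0 \<le> code_weight n p D y"
proof -
  \<comment> \<open>\<open>w b x\<close> is the joint probability that a fair bit is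
    \<open>x\<close> and its thinned version is \<open>b\<close>, a one surviving with probability
    \<open>2 * p\<close>. The entry \<open>1/2 - p\<close> is where \<open>p \<le> 1/2\<close>
    enters.\<close>
  define w :: "bool \<Rightarrow> bool \<Rightarrow> real" where
    "w b x = (if b then (if x then p else 0) else (if x then 1/2 - p else 1/2))" for b x
  \<comment> \<open>\<open>x\<close> stands for a bit before the thinning and \<open>s\<close> for the characters\<close>
  define s :: "bool \<Rightarrow> bool \<Rightarrow> real" where "s x c = (if c \<and> \<not> x then - 1 else 1)" for x c
  have split: "(if y i then p else if c i = c' i then 1 - p else - p) =
      w (y i) True * s True (c i) * s True (c' i) + w (y i) False * s False (c i) * s False (c' i)"
    for i and c c' :: "nat \<Rightarrow> bool"
    by (auto simp: w_def s_def)
  have "(\<Sum>c\<in>D. \<Sum>c'\<in>D. \<Prod>i<n. if y i then p else if c i = c' i then 1 - p else - p) =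
      (\<Sum>c\<in>D. \<Sum>c'\<in>D. \<Sum>x\<in>bitvecs n. \<Prod>i<n. w (y i) (x i) * s (x i) (c i) * s (x i) (c' i))"
    unfolding split by (subst sum_prod_bitvecs) simp
  also have "\<dots> = (\<Sum>c\<in>D. \<Sum>x\<in>bitvecs n. \<Sum>c'\<in>D. \<Prod>i<n. w (y i) (x i) * s (x i) (c i) * s (x i) (c' i))"
    by (intro sum.cong refl sum.swap)
  also have "\<dots> = (\<Sum>x\<in>bitvecs n. \<Sum>c\<in>D. \<Sum>c'\<in>D. \<Prod>i<n. w (y i) (x i) * s (x i) (c i) * s (x i) (c' i))"
    by (rule sum.swap)
  also have "\<dots> = (\<Sum>x\<in>bitvecs n. (\<Prod>i<n. w (y i) (x i)) * (\<Sum>c\<in>D. \<Prod>i<n. s (x i) (c i))\<^sup>2)"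
    unfolding power2_eq_square sum_product
    by (simp add: prod.distrib sum_distrib_left mult.assoc)
  also have "\<dots> \<ge> 0"
    using p by (intro sum_nonneg mult_nonneg_nonneg prod_nonneg) (auto simp: w_def)
  finally show ?thesis by (simp add: code_weight_def)
qed

lemma prob_bernoulli_pmf:
  assumes "p \<in> {0..1}"
  shows "measure_pmf.prob (bernoulli_pmf p) B = of_bool (True \<in> B) * p + of_bool (False \<in> B) * (1 - p)"
proof -
  have "measure_pmf.prob (bernoulli_pmf p) B = (\<Sum>b\<in>B. pmf (bernoulli_pmf p) b)"
    by (rule measure_measure_pmf_finite) simp
  also have "\<dots> = (\<Sum>b\<in>UNIV. of_bool (b \<in> B) * pmf (bernoulli_pmf p) b)"
    by (rule sum.mono_neutral_cong_left) auto
  finally show ?thesis using assms by (simp add: UNIV_bool)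
qed

text \<open>Distinct codewords differ at some coordinate outside \<open>L\<close>; there both bit
  values are summed, and \<open>p\<close> and \<open>- p\<close> cancel. Only the diagonal pairs
  remain, each giving the Bernoulli product, and \<open>card D\<close> normalises.\<close>

lemma sum_code_weight:
  assumes p: "p \<in> {0..1}" and D: "code n k D" and L: "L \<subseteq> {..<n}" "card L \<le> k"
  shows "(\<Sum>y\<in>bitvecs n \<inter> {y. \<forall>j\<in>L. y j \<in> A j}. code_weight n p D y) =
           (\<Prod>j\<in>L. measure_pmf.prob (bernoulli_pmf p) (A j))"
proof -
  define g where "g b e = (if b then p else if e then 1 - p else - p)" for b e
  define h :: "(nat \<Rightarrow> bool) \<Rightarrow> (nat \<Rightarrow> bool) \<Rightarrow> nat \<Rightarrow> bool \<Rightarrow> real" where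
    "h c c' i b = of_bool (i \<in> L \<longrightarrow> b \<in> A i) * g b (c i = c' i)" for c c' i b
  have fin: "finite D" and card: "card D > 0"
    using D finite_subset[OF _ finite_bitvecs] by (auto simp: code_def card_gt_0_iff)
  have ind: "(\<Prod>i<n. of_bool (i \<in> L \<longrightarrow> y i \<in> A i) :: real) = of_bool (\<forall>j\<in>L. y j \<in> A j)" for y
    using L(1) by (auto simp: prod_zero_iff)
  have pair: "(\<Prod>i<n. h c c' i True + h c c' i False) =
      of_bool (c = c') * (\<Prod>j\<in>L. measure_pmf.prob (bernoulli_pmf p) (A j))"
    if c: "c \<in> D" "c' \<in> D" for c c'
  proof (cases "c = c'")
    case True
    have "(\<Prod>i<n. h c c' i True + h c c' i False) =
        (\<Prod>i<n. if i \<in> L then measure_pmf.prob (bernoulli_pmf p) (A i) else 1)"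
      using True by (intro prod.cong) (auto simp: h_def g_def prob_bernoulli_pmf[OF p])
    also have "\<dots> = (\<Prod>j\<in>L. measure_pmf.prob (bernoulli_pmf p) (A j))"
      using L(1) by (simp add: prod.If_cases Int_absorb1)
    finally show ?thesis using True by simp
  next
    case False
    have "\<not> {i. i < n \<and> c i \<noteq> c' i} \<subseteq> L"
    proof
      assume "{i. i < n \<and> c i \<noteq> c' i} \<subseteq> L"
      hence "hamming n c c' \<le> card L"
        unfolding hamming_def using L(1) finite_subset by (intro card_mono) auto
      thus False using D c False L(2) unfolding code_def by fastforce
    qed
    then obtain i where "i < n" "c i \<noteq> c' i" "i \<notin> L" by blast
    hence "(\<Prod>i<n. h c c' i True + h c c' i False) = 0"
      by (intro prod_zero) (auto simp: h_def g_def intro!: bexI[of _ i])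
    thus ?thesis using False by simp
  qed
  have "(\<Sum>y\<in>bitvecs n \<inter> {y. \<forall>j\<in>L. y j \<in> A j}. code_weight n p D y) =
      (\<Sum>y\<in>bitvecs n. of_bool (\<forall>j\<in>L. y j \<in> A j) * code_weight n p D y)"
    by (rule sum.mono_neutral_cong_left) (auto simp: finite_bitvecs)
  also have "\<dots> = (\<Sum>y\<in>bitvecs n. \<Sum>c\<in>D. \<Sum>c'\<in>D. \<Prod>i<n. h c c' i (y i)) / card D"
    by (simp add: code_weight_def ind[symmetric] h_def g_def prod.distrib sum_distrib_left
        sum_divide_distrib)
  also have "(\<Sum>y\<in>bitvecs n. \<Sum>c\<in>D. \<Sum>c'\<in>D. \<Prod>i<n. h c c' i (y i)) =
      (\<Sum>c\<in>D. \<Sum>y\<in>bitvecs n. \<Sum>c'\<in>D. \<Prod>i<n. h c c' i (y i))"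
    by (rule sum.swap)
  also have "\<dots> = (\<Sum>c\<in>D. \<Sum>c'\<in>D. \<Sum>y\<in>bitvecs n. \<Prod>i<n. h c c' i (y i))"
    by (intro sum.cong refl sum.swap)
  also have "\<dots> = (\<Sum>c\<in>D. \<Sum>c'\<in>D. of_bool (c = c') * (\<Prod>j\<in>L. measure_pmf.prob (bernoulli_pmf p) (A j)))"
    by (intro sum.cong refl) (simp add: sum_prod_bitvecs pair)
  also have "\<dots> = (\<Sum>c\<in>D. \<Prod>j\<in>L. measure_pmf.prob (bernoulli_pmf p) (A j))"
    using fin by (simp add: of_bool_def if_distrib[where f = "\<lambda>u. u * _"] sum.delta cong: if_cong)
  finally show ?thesis using card by simp
qed

lemma code_pmf_exists:
  fixes p :: real
  assumes p: "0 \<le> p" "p \<le> 1/2" and D: "code n k D"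
  obtains Q where "set_pmf Q \<subseteq> bitvecs n"
    and "\<And>L A. L \<subseteq> {..<n} \<Longrightarrow> card L \<le> k \<Longrightarrow> measure_pmf.prob Q {x. \<forall>j\<in>L. x j \<in> A j} =
           (\<Prod>j\<in>L. measure_pmf.prob (bernoulli_pmf p) (A j))"
    and "measure_pmf.prob Q {x. \<forall>j<n. x j} = card D * p ^ n"
proof -
  define f where "f y = of_bool (y \<in> bitvecs n) * code_weight n p D y" for y
  have p': "p \<in> {0..1}" using p by auto
  have nn: "0 \<le> f y" for y using code_weight_nonneg[OF p] by (simp add: f_def)
  have "(\<integral>\<^sup>+ y. ennreal (f y) \<partial>count_space UNIV) = (\<integral>\<^sup>+ y. ennreal (f y) \<partial>count_space (bitvecs n))"
    by (rule nn_integral_count_space_eq) (auto simp: f_def)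
  also have "\<dots> = ennreal (\<Sum>y\<in>bitvecs n. f y)"
    using nn by (simp add: nn_integral_count_space_finite finite_bitvecs)
  \<comment> \<open>With no coordinate constrained, the marginal formula gives the total
    mass.\<close>
  also have "(\<Sum>y\<in>bitvecs n. f y) = 1"
    using sum_code_weight[OF p' D, of "{}"] by (simp add: f_def)
  finally have one: "(\<integral>\<^sup>+ y. ennreal (f y) \<partial>count_space UNIV) = 1" by simp
  define Q where "Q = embed_pmf f"
  have Q: "pmf Q y = f y" for y
    unfolding Q_def by (rule pmf_embed_pmf[OF nn one])
  have sub: "set_pmf Q \<subseteq> bitvecs n" by (auto simp: set_pmf_eq Q f_def)
  have prob: "measure_pmf.prob Q S = (\<Sum>y\<in>bitvecs n \<inter> S. code_weight n p D y)" for S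
    by (simp add: prob_bitvecs[OF sub] Q f_def)
  define e where "e i \<longleftrightarrow> i < n" for i
  have e: "bitvecs n \<inter> {x. \<forall>j<n. x j} = {e}"
    by (auto simp: bitvecs_def PiE_dflt_def e_def fun_eq_iff)
  have card: "card D > 0"
    using D finite_subset[OF _ finite_bitvecs] by (auto simp: code_def card_gt_0_iff)
  \<comment> \<open>At \<open>e\<close> every factor is \<open>p\<close>, so each ordered pair of
    codewords contributes \<open>p ^ n\<close>; one of the two factors \<open>card D\<close> is
    divided out.\<close>
  have "measure_pmf.prob Q {x. \<forall>j<n. x j} = card D * p ^ n"
    unfolding prob e using card by (simp add: code_weight_def e_def)
  moreover have "measure_pmf.prob Q {x. \<forall>j\<in>L. x j \<in> A j} =
           (\<Prod>j\<in>L. measure_pmf.prob (bernoulli_pmf p) (A j))" if "L \<subseteq> {..<n}" "card L \<le> k" for L A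
    unfolding prob by (rule sum_code_weight[OF p' D that])
  ultimately show ?thesis using that sub by blast
qed


section \<open>Blocks of independent copies\<close>

text \<open>Singletons, available because \<open>1 \<le> k\<close>, fix the law of each bit; the
  Bernoulli factors can then be rewritten as marginals of \<open>Q\<close>, which is
  independence.\<close>

lemma kwise_distsI:
  assumes p: "p \<in> {0..1}" and k: "1 \<le> k" and Q: "set_pmf Q \<subseteq> bitvecs n"
    and prob: "\<And>L A. L \<subseteq> {..<n} \<Longrightarrow> card L \<le> k \<Longrightarrow>
      measure_pmf.prob Q {x. \<forall>j\<in>L. x j \<in> A j} = (\<Prod>j\<in>L. measure_pmf.prob (bernoulli_pmf p) (A j))"
  shows "Q \<in> kwise_dists n k p"
proof -
  have one: "measure_pmf.prob Q {x. x i \<in> B} = measure_pmf.prob (bernoulli_pmf p) B" if "i < n" for i B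
    using prob[of "{i}" "\<lambda>_. B"] that k by simp
  have "measure_pmf.prob Q {x. x i} = p" if "i < n" for i
    using one[OF that, of "{True}"] p by (simp add: measure_pmf_single)
  moreover have "kwise_indep n k Q"
    unfolding kwise_indep_def indep_vars_pmf_iff
  proof (intro allI impI)
    fix J L :: "nat set" and A
    assume J: "J \<subseteq> {..<n}" "card J \<le> k" and L: "L \<subseteq> J"
    have "finite J" using J(1) by (rule finite_subset) simp
    hence "card L \<le> k" using card_mono[OF _ L] J(2) by fastforce
    hence "measure_pmf.prob Q {x. \<forall>j\<in>L. x j \<in> A j} = (\<Prod>j\<in>L. measure_pmf.prob (bernoulli_pmf p) (A j))"
      using J L by (intro prob) auto
    also have "\<dots> = (\<Prod>j\<in>L. measure_pmf.prob Q {x. x j \<in> A j})"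
      using J L by (intro prod.cong refl) (auto simp: one)
    finally show "measure_pmf.prob Q {x. \<forall>j\<in>L. x j \<in> A j} =
        (\<Prod>j\<in>L. measure_pmf.prob Q {x. x j \<in> A j})" .
  qed
  ultimately show ?thesis using Q by (simp add: kwise_dists_def)
qed

lemma kwise_dists_antimono: "k \<le> k' \<Longrightarrow> kwise_dists n k' p \<subseteq> kwise_dists n k p"
  by (auto simp: kwise_dists_def kwise_indep_def)

lemma prob_kwise_all_ones:
  assumes Q: "Q \<in> kwise_dists n k p" and L: "L \<subseteq> {..<n}" "card L \<le> k"
  shows "measure_pmf.prob Q {x. \<forall>j\<in>L. x j} = p ^ card L"
proof (cases "L = {}")
  case False
  have "finite L" using L(1) finite_subset by blast
  moreover have indep: "prob_space.indep_vars (measure_pmf Q) (\<lambda>_. count_space UNIV) (\<lambda>i x. x i) L"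
    using Q L by (simp add: kwise_dists_def kwise_indep_def)
  ultimately have "measure_pmf.prob Q {x. \<forall>j\<in>L. x j} = (\<Prod>j\<in>L. measure_pmf.prob Q {x. x j})"
    using indep_vars_pmf_iff[THEN iffD1, OF indep, rule_format, of L "\<lambda>_. {True}"] False by simp
  also have "\<dots> = (\<Prod>j\<in>L. p)"
    using Q L(1) by (intro prod.cong) (auto simp: kwise_dists_def)
  finally show ?thesis by simp
qed simp

text \<open>\<open>M\<close> independent samples of \<open>Q\<close> are laid out as consecutive
  blocks of length \<open>m\<close>. The conjunct \<open>l < M * m\<close> pins the remaining
  coordinates to \<open>False\<close>, as \<open>bitvecs\<close> requires.\<close>

definition block_pmf :: "nat \<Rightarrow> nat \<Rightarrow> (nat \<Rightarrow> bool) pmf \<Rightarrow> (nat \<Rightarrow> bool) pmf" where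
  "block_pmf m M Q =
     map_pmf (\<lambda>z l. l < M * m \<and> z (l div m) (l mod m)) (Pi_pmf {..<M} (\<lambda>_. False) (\<lambda>_. Q))"

lemma block_index_less:
  fixes i j m M :: nat
  assumes "i < M" "j < m"
  shows "i * m + j < M * m"
proof -
  have "i * m + j < Suc i * m" using assms by simp
  also have "\<dots> \<le> M * m" using assms by (intro mult_right_mono) auto
  finally show ?thesis .
qed

text \<open>The preimage of \<open>S\<close> under the layout map is a box, whose product measure
  factors.\<close>

lemma prob_block_pmf:
  assumes S: "\<And>z. (\<lambda>l. l < M * m \<and> z (l div m) (l mod m)) \<in> S \<longleftrightarrow> (\<forall>i<M. z i \<in> B i)"
  shows "measure_pmf.prob (block_pmf m M Q) S = (\<Prod>i<M. measure_pmf.prob Q (B i))"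
proof -
  have "(\<lambda>z l. l < M * m \<and> z (l div m) (l mod m)) -` S = Pi {..<M} B"
    using S by (auto simp: Pi_def)
  thus ?thesis
    unfolding block_pmf_def by (simp add: measure_Pi_pmf_Pi)
qed

text \<open>The trace \<open>K i\<close> of \<open>L\<close> on each block has at most
  \<open>k\<close> elements, so the hypothesis on \<open>Q\<close> applies block by block, and
  independence of the blocks multiplies the results.\<close>

lemma block_pmf_in_kwise_dists:
  assumes p: "p \<in> {0..1}" and k: "1 \<le> k" and m: "1 \<le> m"
    and prob: "\<And>L A. L \<subseteq> {..<m} \<Longrightarrow> card L \<le> k \<Longrightarrow>
      measure_pmf.prob Q {x. \<forall>j\<in>L. x j \<in> A j} = (\<Prod>j\<in>L. measure_pmf.prob (bernoulli_pmf p) (A j))"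
  shows "block_pmf m M Q \<in> kwise_dists (M * m) k p"
proof (rule kwise_distsI[OF p k])
  show "set_pmf (block_pmf m M Q) \<subseteq> bitvecs (M * m)"
    by (auto simp: block_pmf_def bitvecs_def PiE_dflt_def)
next
  fix L A assume L: "L \<subseteq> {..<M * m}" "card L \<le> k"
  let ?b = "\<lambda>B. measure_pmf.prob (bernoulli_pmf p) B"
  define K where "K i = {j. j < m \<and> i * m + j \<in> L}" for i
  have "card (K i) \<le> card L" for i
    by (rule card_inj_on_le[of "\<lambda>j. i * m + j"])
       (use L(1) finite_subset in \<open>auto simp: K_def inj_on_def\<close>)
  hence K: "K i \<subseteq> {..<m}" "card (K i) \<le> k" for i
    using L(2) by (auto simp: K_def intro: le_trans)
  have "measure_pmf.prob (block_pmf m M Q) {x. \<forall>j\<in>L. x j \<in> A j} =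
      (\<Prod>i<M. measure_pmf.prob Q {x. \<forall>j\<in>K i. x j \<in> A (i * m + j)})"
  proof (rule prob_block_pmf)
    fix z :: "nat \<Rightarrow> nat \<Rightarrow> bool"
    let ?x = "\<lambda>l. l < M * m \<and> z (l div m) (l mod m)"
    have "(\<forall>l\<in>L. ?x l \<in> A l) \<longleftrightarrow> (\<forall>i<M. \<forall>j\<in>K i. z i j \<in> A (i * m + j))"
    proof (intro iffI allI impI ballI)
      fix i j assume H: "\<forall>l\<in>L. ?x l \<in> A l" "i < M" "j \<in> K i"
      have "i * m + j \<in> L" "j < m" using H by (auto simp: K_def)
      moreover have "i * m + j < M * m" using H by (intro block_index_less) (auto simp: K_def)
      ultimately show "z i j \<in> A (i * m + j)" using H(1) by force
    next
      fix l assume H: "\<forall>i<M. \<forall>j\<in>K i. z i j \<in> A (i * m + j)" "l \<in> L"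
      have "l < M * m" using H L by auto
      hence "l div m < M" by (simp add: less_mult_imp_div_less)
      moreover have "l mod m \<in> K (l div m)" using H(2) m by (simp add: K_def)
      ultimately have "z (l div m) (l mod m) \<in> A (l div m * m + l mod m)" using H(1) by blast
      thus "?x l \<in> A l" using \<open>l < M * m\<close> by simp
    qed
    thus "?x \<in> {x. \<forall>j\<in>L. x j \<in> A j} \<longleftrightarrow> (\<forall>i<M. z i \<in> {x. \<forall>j\<in>K i. x j \<in> A (i * m + j)})"
      by simp
  qed
  also have "\<dots> = (\<Prod>i<M. \<Prod>j\<in>K i. ?b (A (i * m + j)))"
    by (intro prod.cong refl prob K)
  \<comment> \<open>Padding with ones outside \<open>L\<close> makes all blocks full intervals,
    which concatenate to \<open>{..<M * m}\<close>.\<close>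
  also have "\<dots> = (\<Prod>i<M. \<Prod>l\<in>{i * m..<i * m + m}. if l \<in> L then ?b (A l) else 1)"
  proof (rule prod.cong[OF refl])
    fix i
    have "(\<Prod>l\<in>{i * m..<i * m + m}. if l \<in> L then ?b (A l) else 1) =
        (\<Prod>j\<in>{0..<m}. if i * m + j \<in> L then ?b (A (i * m + j)) else 1)"
      using prod.shift_bounds_nat_ivl[of "\<lambda>l. if l \<in> L then ?b (A l) else 1" 0 "i * m" m]
      by (simp add: add.commute cong: if_cong)
    also have "\<dots> = (\<Prod>j\<in>K i. ?b (A (i * m + j)))"
      by (rule prod.mono_neutral_cong_right) (auto simp: K_def)
    finally show "(\<Prod>j\<in>K i. ?b (A (i * m + j))) =
        (\<Prod>l\<in>{i * m..<i * m + m}. if l \<in> L then ?b (A l) else 1)" ..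
  qed
  also have "\<dots> = (\<Prod>l<M * m. if l \<in> L then ?b (A l) else 1)"
    by (rule prod.nat_group)
  also have "\<dots> = (\<Prod>l\<in>L. ?b (A l))"
    using L(1) by (simp add: prod.If_cases Int_absorb1)
  finally show "measure_pmf.prob (block_pmf m M Q) {x. \<forall>j\<in>L. x j \<in> A j} = (\<Prod>l\<in>L. ?b (A l))" .
qed

text \<open>Tribes fails exactly when every block fails to be all ones, and the blocks are
  independent.\<close>

lemma prob_block_pmf_tribes:
  assumes m: "1 \<le> m"
  shows "measure_pmf.prob (block_pmf m (2 ^ m) Q) {x. tribes (m * 2 ^ m) x} =
           1 - (1 - measure_pmf.prob Q {x. \<forall>j<m. x j}) ^ (2 ^ m)"
proof -
  let ?P = "block_pmf m (2 ^ m) Q"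
  have "measure_pmf.prob ?P (UNIV - {x. tribes (m * 2 ^ m) x}) =
      (\<Prod>i<(2 ^ m :: nat). measure_pmf.prob Q (UNIV - {x. \<forall>j<m. x j}))"
  proof (rule prob_block_pmf)
    fix z :: "nat \<Rightarrow> nat \<Rightarrow> bool"
    have "i * m + j < 2 ^ m * m" if "i < 2 ^ m" "j < m" for i j
      using that by (rule block_index_less)
    thus "(\<lambda>l. l < 2 ^ m * m \<and> z (l div m) (l mod m)) \<in> UNIV - {x. tribes (m * 2 ^ m) x} \<longleftrightarrow>
        (\<forall>i<2 ^ m. z i \<in> UNIV - {x. \<forall>j<m. x j})"
      using m by (auto simp: tribes_def tribe_size_input)
  qed
  thus ?thesis
    using measure_pmf.prob_compl[of "{x. tribes (m * 2 ^ m) x}" ?P]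
      measure_pmf.prob_compl[of "{x. \<forall>j<m. x j}" Q]
    by simp
qed


lemma tribes_from_block_code:
  assumes k: "1 \<le> k" "8 * k \<le> m"
  obtains Q where "Q \<in> kwise_dists (m * 2 ^ m) k (2/5)"
    and "1 - exp (- 1) \<le> measure_pmf.prob Q {x. tribes (m * 2 ^ m) x}"
proof -
  obtain D where D: "code m k D" and large: "2 ^ m * (1/4) ^ k \<le> card D * (1 + 1/4 :: real) ^ m"
    using large_code_exists[of "1/4" m k] by auto
  \<comment> \<open>The ratio 8 between \<open>m\<close> and \<open>k\<close> is chosen so that
    \<open>(5/4) ^ 8\<close> exceeds 4, the reciprocal of the weight \<open>t = 1/4\<close>.\<close>
  have "(4 :: real) ^ k \<le> ((5/4) ^ 8) ^ k"
    by (intro power_mono) (simp_all add: power_divide)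
  also have "\<dots> \<le> (5/4) ^ m"
    unfolding power_mult[symmetric] using k by (intro power_increasing) auto
  finally have four: "(4 :: real) ^ k \<le> (5/4) ^ m" .
  have "(2 :: real) ^ m = 2 ^ m * (1/4) ^ k * 4 ^ k"
    by (simp add: power_divide)
  also have "\<dots> \<le> (card D * (5/4) ^ m) * (5/4) ^ m"
    by (rule mult_mono) (use large four in simp_all)
  also have "\<dots> = card D * (25/16) ^ m"
    by (simp add: power_mult_distrib[symmetric] mult.assoc)
  \<comment> \<open>The margin \<open>25/16 \<le> 8/5\<close> is what makes \<open>p = 2/5\<close>
    work: \<open>8/5\<close> is \<open>2 * (2 * p)\<close>.\<close>
  also have "\<dots> \<le> card D * (8/5) ^ m"
    by (intro mult_left_mono power_mono) auto
  also have "\<dots> = 2 ^ m * (card D * (4/5) ^ m)"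
    by (simp add: mult.left_commute[of "2 ^ m"] power_mult_distrib[symmetric])
  finally have "1 \<le> card D * (4/5 :: real) ^ m" by simp
  \<comment> \<open>The expected number of all-ones tribes is at least 1.\<close>
  hence ge: "1 \<le> 2 ^ m * (card D * (2/5 :: real) ^ m)"
    by (simp add: mult.left_commute[of "2 ^ m"] power_mult_distrib[symmetric])
  obtain Q where Q: "set_pmf Q \<subseteq> bitvecs m"
      "\<And>L A. L \<subseteq> {..<m} \<Longrightarrow> card L \<le> k \<Longrightarrow> measure_pmf.prob Q {x. \<forall>j\<in>L. x j \<in> A j} =
         (\<Prod>j\<in>L. measure_pmf.prob (bernoulli_pmf (2/5)) (A j))"
      "measure_pmf.prob Q {x. \<forall>j<m. x j} = card D * (2/5) ^ m"
    using code_pmf_exists[OF _ _ D, of "2/5"] by auto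
  define q where "q = measure_pmf.prob Q {x. \<forall>j<m. x j}"
  have "q \<le> 1" by (simp add: q_def)
  hence "(1 - q) ^ (2 ^ m) \<le> exp (- q) ^ (2 ^ m)"
    using exp_ge_add_one_self[of "- q"] by (intro power_mono) auto
  also have "\<dots> = exp (- (2 ^ m * q))"
    by (simp add: exp_of_nat_mult[symmetric])
  also have "\<dots> \<le> exp (- 1)"
    using ge Q(3) by (simp add: q_def)
  finally have "1 - exp (- 1) \<le> measure_pmf.prob (block_pmf m (2 ^ m) Q) {x. tribes (m * 2 ^ m) x}"
    using prob_block_pmf_tribes[of m Q] k by (simp add: q_def)
  moreover have "block_pmf m (2 ^ m) Q \<in> kwise_dists (2 ^ m * m) k (2/5)"
    using k by (intro block_pmf_in_kwise_dists Q(2)) auto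
  ultimately show ?thesis using that by (simp add: mult.commute)
qed


section \<open>Moment bounds for Tribes\<close>

text \<open>Second moment method: the number \<open>Y\<close> of events that occur has mean \<mu>
  and, by pairwise independence, second central moment at most \<mu>. Off the union \<open>Y\<close>
  is 0, so \<open>(Y x - \<mu>)\<^sup>2\<close> equals \<open>\<mu>\<^sup>2\<close> there.\<close>

lemma pairwise_independent_union_ge:
  fixes Q :: "'a pmf" and E :: "'i \<Rightarrow> 'a set" and q :: real
  assumes I: "finite I" "I \<noteq> {}" and q: "0 < q"
    and E: "\<And>i. i \<in> I \<Longrightarrow> measure_pmf.prob Q (E i) = q"
    and EE: "\<And>i j. i \<in> I \<Longrightarrow> j \<in> I \<Longrightarrow> i \<noteq> j \<Longrightarrow> measure_pmf.prob Q (E i \<inter> E j) = q\<^sup>2"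
  shows "1 - 1 / (card I * q) \<le> measure_pmf.prob Q (\<Union>i\<in>I. E i)"
proof -
  define \<mu> where "\<mu> = card I * q"
  have \<mu>: "\<mu> > 0" using I q by (simp add: \<mu>_def card_gt_0_iff)
  define Y :: "'a \<Rightarrow> real" where "Y x = (\<Sum>i\<in>I. indicator (E i) x)" for x
  define U where "U = (\<Union>i\<in>I. E i)"
  have int: "integrable (measure_pmf Q) (indicator S :: 'a \<Rightarrow> real)" for S
    by (intro integrable_real_indicator) (auto simp: less_top[symmetric])
  have Y2: "(Y x - \<mu>)\<^sup>2 = (\<Sum>i\<in>I. \<Sum>j\<in>I. indicator (E i \<inter> E j) x) - 2 * \<mu> * (\<Sum>i\<in>I. indicator (E i) x) + \<mu>\<^sup>2"
    for x
  proof -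
    have "(Y x)\<^sup>2 = (\<Sum>i\<in>I. \<Sum>j\<in>I. indicator (E i \<inter> E j) x)"
      by (simp add: Y_def power2_eq_square sum_product indicator_inter_arith)
    thus ?thesis by (simp add: power2_diff) (simp add: Y_def)
  qed
  have le: "(\<Sum>j\<in>I. measure_pmf.prob Q (E i \<inter> E j)) \<le> q + card I * q\<^sup>2" if "i \<in> I" for i
  proof -
    \<comment> \<open>The diagonal term \<open>q\<close> is relaxed to \<open>q + q\<^sup>2\<close>;
      the double sum is then at most \<open>\<mu> + \<mu>\<^sup>2\<close>, and the quadratic terms
      cancel below.\<close>
    have "(\<Sum>j\<in>I. measure_pmf.prob Q (E i \<inter> E j)) \<le> (\<Sum>j\<in>I. (if i = j then q else 0) + q\<^sup>2)"
      using that E EE by (intro sum_mono) auto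
    also have "\<dots> = q + card I * q\<^sup>2"
      using that I by (simp add: sum.distrib)
    finally show ?thesis .
  qed
  have "measure_pmf.prob Q (- U) * \<mu>\<^sup>2 = measure_pmf.expectation Q (\<lambda>x. indicator (- U) x * \<mu>\<^sup>2)"
    by simp
  also have "\<dots> \<le> measure_pmf.expectation Q (\<lambda>x. (Y x - \<mu>)\<^sup>2)"
  proof (rule integral_mono)
    show "integrable (measure_pmf Q) (\<lambda>x. (Y x - \<mu>)\<^sup>2)"
      unfolding Y2 by (simp add: int)
    show "integrable (measure_pmf Q) (\<lambda>x. indicator (- U) x * \<mu>\<^sup>2)"
      by (intro integrable_mult_left int)
    fix x
    have "Y x = 0" if "x \<notin> U"
      using that unfolding Y_def U_def by (intro sum.neutral) auto
    thus "indicator (- U) x * \<mu>\<^sup>2 \<le> (Y x - \<mu>)\<^sup>2"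
      by (cases "x \<in> U") auto
  qed
  also have "\<dots> = (\<Sum>i\<in>I. \<Sum>j\<in>I. measure_pmf.prob Q (E i \<inter> E j)) -
      2 * \<mu> * (\<Sum>i\<in>I. measure_pmf.prob Q (E i)) + \<mu>\<^sup>2"
    unfolding Y2 using int by simp
  also have "\<dots> \<le> (\<Sum>i\<in>I. q + card I * q\<^sup>2) - 2 * \<mu> * (\<Sum>i\<in>I. q) + \<mu>\<^sup>2"
    using le E by (intro add_mono diff_mono sum_mono) auto
  also have "\<dots> = \<mu>"
    by (simp add: \<mu>_def power2_eq_square algebra_simps)
  finally have "measure_pmf.prob Q (- U) \<le> 1 / \<mu>"
    using \<mu> by (simp add: field_simps power2_eq_square)
  moreover have "measure_pmf.prob Q (- U) = 1 - measure_pmf.prob Q U"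
    using measure_pmf.prob_compl[of U Q] by (simp add: Compl_eq_Diff_UNIV)
  ultimately show ?thesis by (simp add: \<mu>_def U_def)
qed

definition tribe :: "nat \<Rightarrow> nat \<Rightarrow> nat set" where
  "tribe m i = (\<lambda>j. i * m + j) ` {..<m}"

lemma tribes_iff: "1 \<le> m \<Longrightarrow> tribes (m * 2 ^ m) x \<longleftrightarrow> (\<exists>i<2 ^ m. \<forall>l\<in>tribe m i. x l)"
  by (auto simp: tribes_def tribe_size_input tribe_def)

lemma card_tribe: "card (tribe m i) = m"
  by (simp add: tribe_def card_image inj_on_def)

lemma finite_tribe: "finite (tribe m i)"
  by (simp add: tribe_def)

lemma tribe_subset: "i < 2 ^ m \<Longrightarrow> tribe m i \<subseteq> {..<m * 2 ^ m}"
  by (auto simp: tribe_def tribe_bit_less)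

lemma tribe_disjoint:
  assumes "i \<noteq> i'"
  shows "tribe m i \<inter> tribe m i' = {}"
proof -
  have "l div m = i" if "l \<in> tribe m i" for l i
    using that by (auto simp: tribe_def)
  with assms show ?thesis by blast
qed

lemma prob_tribes_le:
  assumes Q: "Q \<in> kwise_dists (m * 2 ^ m) k p" and m: "1 \<le> m" "m \<le> k"
  shows "measure_pmf.prob Q {x. tribes (m * 2 ^ m) x} \<le> (2 * p) ^ m"
proof -
  have "{x. tribes (m * 2 ^ m) x} = (\<Union>i<2 ^ m. {x. \<forall>l\<in>tribe m i. x l})"
    using m by (auto simp: tribes_iff)
  hence "measure_pmf.prob Q {x. tribes (m * 2 ^ m) x} \<le>
      (\<Sum>i<(2 ^ m :: nat). measure_pmf.prob Q {x. \<forall>l\<in>tribe m i. x l})"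
    by (simp add: measure_pmf.finite_measure_subadditive_finite)
  also have "\<dots> = (\<Sum>i<(2 ^ m :: nat). p ^ m)"
    using m by (intro sum.cong refl) (simp add: prob_kwise_all_ones[OF Q tribe_subset] card_tribe)
  finally show ?thesis by (simp add: power_mult_distrib)
qed

text \<open>Two distinct tribes together occupy \<open>2 * m\<close> bits, so
  \<open>2 * m \<le> k\<close> makes the tribe events pairwise independent; their expected number is
  \<open>(2 * p) ^ m\<close>.\<close>

lemma prob_tribes_ge:
  assumes Q: "Q \<in> kwise_dists (m * 2 ^ m) k p" and m: "1 \<le> m" "2 * m \<le> k" and p: "0 < p"
  shows "1 - 1 / (2 * p) ^ m \<le> measure_pmf.prob Q {x. tribes (m * 2 ^ m) x}"
proof -
  define E where "E i = {x. \<forall>l\<in>tribe m i. x l}" for i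
  have "{x. tribes (m * 2 ^ m) x} = (\<Union>i\<in>{..<2 ^ m}. E i)"
    using m by (auto simp: tribes_iff E_def)
  moreover have "1 - 1 / (card {..<2 ^ m :: nat} * p ^ m) \<le> measure_pmf.prob Q (\<Union>i\<in>{..<2 ^ m}. E i)"
  proof (rule pairwise_independent_union_ge)
    fix i :: nat assume i: "i \<in> {..<2 ^ m}"
    show "measure_pmf.prob Q (E i) = p ^ m"
      using i m prob_kwise_all_ones[OF Q tribe_subset, of i] by (simp add: E_def card_tribe)
    fix j :: nat assume j: "j \<in> {..<2 ^ m}" "i \<noteq> j"
    have card: "card (tribe m i \<union> tribe m j) = 2 * m"
      using j by (simp add: card_Un_disjoint finite_tribe tribe_disjoint card_tribe)
    have "E i \<inter> E j = {x. \<forall>l\<in>tribe m i \<union> tribe m j. x l}" by (auto simp: E_def)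
    also have "measure_pmf.prob Q \<dots> = p ^ card (tribe m i \<union> tribe m j)"
      using i j m tribe_subset card by (intro prob_kwise_all_ones[OF Q]) auto
    finally show "measure_pmf.prob Q (E i \<inter> E j) = (p ^ m)\<^sup>2"
      by (simp add: card power_mult mult.commute)
  qed (use p in \<open>auto simp: lessThan_empty_iff\<close>)
  ultimately show ?thesis by (simp add: power_mult_distrib)
qed


section \<open>The bounds on K1\<close>

lemma eps_ge:
  assumes "Q \<in> kwise_dists n k p" "Q' \<in> kwise_dists n k p"
  shows "measure_pmf.prob Q {x. f x} - measure_pmf.prob Q' {x. f x} \<le> eps n f k p"
  unfolding eps_def
  by (intro diff_mono cSUP_upper cINF_lower assms bdd_aboveI2[of _ _ 1] bdd_belowI2[of _ 0]) auto

lemma eps_nonneg: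
  assumes "p \<in> {0..1}"
  shows "0 \<le> eps n f k p"
  using eps_ge[OF Pi_pmf_in_kwise_dists[OF assms] Pi_pmf_in_kwise_dists[OF assms]] by fastforce

lemma eps_le:
  assumes p: "p \<in> {0..1}"
    and Q: "\<And>Q. Q \<in> kwise_dists n k p \<Longrightarrow> a \<le> measure_pmf.prob Q {x. f x}"
      "\<And>Q. Q \<in> kwise_dists n k p \<Longrightarrow> measure_pmf.prob Q {x. f x} \<le> b"
  shows "eps n f k p \<le> b - a"
  \<comment> \<open>The independent distribution shows that the supremum and infimum range over a
    nonempty set.\<close>
  unfolding eps_def using Pi_pmf_in_kwise_dists[OF p, of n k] Q
  by (intro diff_mono cSUP_least cINF_greatest) auto

lemma twice_tribe_size_in_K1: "(\<lambda>n. 2 * tribe_size n) \<in> K1 tribes_inputs tribes (1/2)"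
  unfolding K1_def
proof (intro CollectI ballI impI tendsto_tribes_inputs)
  fix p :: real assume p: "p \<in> {0..1}" "p \<noteq> 1/2"
  define e where "e m = eps (m * 2 ^ m) (tribes (m * 2 ^ m)) (2 * tribe_size (m * 2 ^ m)) p" for m
  \<comment> \<open>The geometric rate from the union bound below 1/2 and from the second moment
    above it; \<open>p \<noteq> 1/2\<close> gives \<open>r < 1\<close> on both sides.\<close>
  define r where "r = (if p < 1/2 then 2 * p else 1 / (2 * p))"
  have "e m \<le> r ^ m" if m: "1 \<le> m" for m
  proof (cases "p < 1/2")
    case True
    have "e m \<le> (2 * p) ^ m - 0"
      unfolding e_def tribe_size_input[OF m]
      using p m prob_tribes_le[of _ m "2 * m" p] by (intro eps_le) auto
    with True show ?thesis by (simp add: r_def)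
  next
    case False
    have "e m \<le> 1 - (1 - 1 / (2 * p) ^ m)"
      unfolding e_def tribe_size_input[OF m]
      using p m False prob_tribes_ge[of _ m "2 * m" p] by (intro eps_le) auto
    with False show ?thesis by (simp add: r_def power_one_over)
  qed
  hence "eventually (\<lambda>m. e m \<le> r ^ m) sequentially"
    by (intro eventually_sequentiallyI)
  moreover have "(\<lambda>m. r ^ m) \<longlonglongrightarrow> 0"
    using p by (intro LIMSEQ_power_zero) (auto simp: r_def)
  moreover have "0 \<le> e m" for m using eps_nonneg p by (simp add: e_def)
  ultimately show "e \<longlonglongrightarrow> 0"
    by (intro tendsto_sandwich[of "\<lambda>_. 0" e _ "\<lambda>m. r ^ m" 0]) auto
qed

text \<open>One bias suffices. At 2/5 both the independent distribution and the block code
  distribution are admissible; their probabilities of Tribes tend to 0 and stay at least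
  \<open>1 - exp (- 1)\<close>, so \<open>eps\<close> cannot vanish.\<close>

lemma small_not_in_K1:
  assumes k: "\<And>n. n \<in> tribes_inputs \<Longrightarrow> 8 * k n \<le> tribe_size n"
  shows "k \<notin> K1 tribes_inputs tribes (1/2)"
proof
  define P where "P n = Pi_pmf {..<n} False (\<lambda>_. bernoulli_pmf (2/5))" for n :: nat
  assume "k \<in> K1 tribes_inputs tribes (1/2)"
  hence "((\<lambda>n. eps n (tribes n) (k n) (2/5)) \<longlongrightarrow> 0) (at_infinity_in tribes_inputs)"
    by (auto simp: K1_def)
  moreover have "((\<lambda>n. measure_pmf.prob (P n) {x. tribes n x}) \<longlongrightarrow> 0) (at_infinity_in tribes_inputs)"
    using sharp_threshold_tribes by (auto simp: sharp_threshold_def P_def Let_def)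
  ultimately have "((\<lambda>n. eps n (tribes n) (k n) (2/5) + measure_pmf.prob (P n) {x. tribes n x}) \<longlongrightarrow> 0 + 0)
      (at_infinity_in tribes_inputs)"
    by (rule tendsto_add)
  hence "eventually (\<lambda>n. eps n (tribes n) (k n) (2/5) + measure_pmf.prob (P n) {x. tribes n x} < 1 - exp (- 1))
      (at_infinity_in tribes_inputs)"
    by (rule order_tendstoD) simp
  then obtain N where N: "\<And>n. n \<ge> N \<Longrightarrow> n \<in> tribes_inputs \<Longrightarrow>
      eps n (tribes n) (k n) (2/5) + measure_pmf.prob (P n) {x. tribes n x} < 1 - exp (- 1)"
    by (auto simp: at_infinity_in_def eventually_inf_principal eventually_sequentially)
  \<comment> \<open>The bound 8 leaves room for \<open>max 1 (k n)\<close>, which replaces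
    \<open>k n\<close> because the code construction needs at least 1; the resulting distribution is
    also admissible for \<open>k n = 0\<close>.\<close>
  define m where "m = max 8 N"
  define n where "n = m * 2 ^ m"
  have n: "n \<in> tribes_inputs" "tribe_size n = m"
    by (auto simp: n_def m_def tribes_inputs_def tribe_size_input)
  have "m * 1 \<le> n" unfolding n_def by (intro mult_left_mono) auto
  hence "N \<le> n" by (simp add: m_def)
  have "8 * max 1 (k n) \<le> m" using k[OF n(1)] n(2) by (simp add: m_def)
  then obtain Q where Q: "Q \<in> kwise_dists n (max 1 (k n)) (2/5)"
      "1 - exp (- 1) \<le> measure_pmf.prob Q {x. tribes n x}"
    using tribes_from_block_code[of "max 1 (k n)" m] by (auto simp: n_def)
  have "Q \<in> kwise_dists n (k n) (2/5)"
    using Q(1) kwise_dists_antimono[of "k n" "max 1 (k n)"] by auto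
  moreover have "P n \<in> kwise_dists n (k n) (2/5)"
    unfolding P_def by (rule Pi_pmf_in_kwise_dists) simp
  ultimately have "measure_pmf.prob Q {x. tribes n x} - measure_pmf.prob (P n) {x. tribes n x} \<le>
      eps n (tribes n) (k n) (2/5)"
    by (rule eps_ge)
  with N[OF \<open>N \<le> n\<close> n(1)] Q(2) show False by simp
qed

theorem theorem11:
  shows "(\<lambda>n. 2 * tribe_size n) \<in> K1 tribes_inputs tribes (1/2) \<and>
    (\<exists>C>0. \<forall>k :: nat \<Rightarrow> nat.
       (\<forall>n\<in>tribes_inputs. real (k n) < C * real (tribe_size n)) \<longrightarrow>
       k \<notin> K1 tribes_inputs tribes (1/2))"
\<comment> \<open>\<open>1/8\<close> is the ratio of \<open>k\<close> to \<open>m\<close> that the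
  code bound allows.\<close>
proof (intro conjI exI[of _ "1/8"] allI impI)
  fix k :: "nat \<Rightarrow> nat"
  assume "\<forall>n\<in>tribes_inputs. real (k n) < 1/8 * real (tribe_size n)"
  thus "k \<notin> K1 tribes_inputs tribes (1/2)"
    by (intro small_not_in_K1) fastforce
qed (use twice_tribe_size_in_K1 in auto)

end
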